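(* There exists a constant $c_2 > 0$ such that for any sequence of positive radii $r_n$ satisfying $$r_n \le \frac{1}{2} + \frac{c_2}{n},$$ there exists $n_0$ such that $\chi(S_{r_n}^{n-1}) \le n+1$ for all $n \ge n_0$.
   Context: $S_r^{n-1} = \{x \in \mathbb{R}^n : \|x\|_2 = r\}$ is the Euclidean sphere of radius $r$ in $\mathbb{R}^n$; $\chi(S_r^{n-1})$ is the minimum number of colours needed to colour its points so that any two points at Euclidean distance exactly $1$ receive different colours. *)

theory Defs
  imports "HOL-Analysis.Analysis" "HOL-Library.Extended_Nat"
begin

(* Since the dimension n varies inside the statement, R^n is the carrier of the library's
   Euclidean_space n: functions nat => real vanishing at all indices i >= n. *)

definition euclid_norm :: "nat \<Rightarrow> (nat \<Rightarrow> real) \<Rightarrow> real" where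
  "euclid_norm n x = L2_set x {..<n}"

definition euclid_dist :: "nat \<Rightarrow> (nat \<Rightarrow> real) \<Rightarrow> (nat \<Rightarrow> real) \<Rightarrow> real" where
  "euclid_dist n x y = euclid_norm n (\<lambda>i. x i - y i)"

(* The argument n is the dimension of the ambient space: this is S_r^{n-1}. *)
definition euclid_sphere :: "nat \<Rightarrow> real \<Rightarrow> (nat \<Rightarrow> real) set" where
  "euclid_sphere n r = {x \<in> topspace (Euclidean_space n). euclid_norm n x = r}"

definition unit_distance_colouring ::
    "nat \<Rightarrow> (nat \<Rightarrow> real) set \<Rightarrow> nat \<Rightarrow> ((nat \<Rightarrow> real) \<Rightarrow> nat) \<Rightarrow> bool" where
  "unit_distance_colouring n S k col \<longleftrightarrow>
     (\<forall>x\<in>S. col x < k) \<and>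
     (\<forall>x\<in>S. \<forall>y\<in>S. euclid_dist n x y = 1 \<longrightarrow> col x \<noteq> col y)"

(* An infimum in enat is attained if the set is nonempty, so this is the minimum number of
   colours; it is infinity if no finite number of colours suffices. *)
definition unit_distance_chromatic_number :: "nat \<Rightarrow> (nat \<Rightarrow> real) set \<Rightarrow> enat" where
  "unit_distance_chromatic_number n S =
     Inf {enat k |k. \<exists>col. unit_distance_colouring n S k col}"

end

theory Submission
  imports Defs
begin

text \<open>
  Cut the sphere into \<open>n + 1\<close> cells: cell \<open>i < n\<close> consists of the points whose largest coordinate
  is the \<open>i\<close>-th one and is nonnegative, and cell \<open>n\<close> of the points without positive coordinates.
  If \<open>x\<close> and \<open>y\<close> lie in the same cell, then each coordinate of \<open>x\<close> is controlled by
  the coordinates of \<open>x + y\<close>, which gives \<open>\<parallel>x\<parallel>\<^sup>2 \<le> 2 (n + 1) \<parallel>x + y\<parallel>\<^sup>2\<close>.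
  For points of the sphere at distance 1 the parallelogram law gives
  \<open>\<parallel>x + y\<parallel>\<^sup>2 = 4 r\<^sup>2 - 1 = O(c / n)\<close>, while \<open>r \<ge> 1 / 2\<close>; this is impossible for small \<open>c\<close>.
\<close>

text \<open>A relation rather than a function: cells overlap when the maximum is attained twice or
  is zero, and a colouring may pick any admissible index.\<close>

definition max_coord_cell :: "nat \<Rightarrow> (nat \<Rightarrow> real) \<Rightarrow> nat \<Rightarrow> bool" where
  "max_coord_cell n x i \<longleftrightarrow>
     (i = n \<and> (\<forall>j<n. x j \<le> 0)) \<or> (i < n \<and> 0 \<le> x i \<and> (\<forall>j<n. x j \<le> x i))"

lemma max_coord_cell_le: "max_coord_cell n x i \<Longrightarrow> i < n + 1"
  by (auto simp: max_coord_cell_def)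

lemma max_coord_cell_exists: "\<exists>i. max_coord_cell n x i"
proof (cases "\<forall>j<n. x j \<le> 0")
  case True
  then show ?thesis by (auto simp: max_coord_cell_def)
next
  case False
  then obtain k where k: "k < n" "x k > 0" by force
  have "finite (x ` {..<n})" "x ` {..<n} \<noteq> {}" using k by auto
  then have "Max (x ` {..<n}) \<in> x ` {..<n}" by (rule Max_in)
  then obtain i where i: "i < n" "x i = Max (x ` {..<n})" by auto
  have le: "x j \<le> x i" if "j < n" for j using that by (auto simp: i(2))
  have "0 \<le> x i" using le[OF k(1)] k(2) by linarith
  then show ?thesis using i(1) le by (auto simp: max_coord_cell_def)
qed

lemma max_coord_cell_sum_squares_le:
  assumes x: "max_coord_cell n x i" and y: "max_coord_cell n y i"
  shows "(\<Sum>j<n. (x j)\<^sup>2) \<le> 2 * (real n + 1) * (\<Sum>j<n. (x j + y j)\<^sup>2)"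
proof -
  define E where "E = (\<Sum>j<n. (x j + y j)\<^sup>2)"
  \<comment> \<open>The default 0 stands for cell \<open>n\<close>, which has no distinguished
    coordinate, so that both kinds of cell obey the same bound.\<close>
  define b where "b = (if i < n then (x i + y i)\<^sup>2 else 0)"
  have E0: "E \<ge> 0" by (simp add: E_def sum_nonneg)
  have b: "b \<le> E"
    unfolding b_def using E0 member_le_sum[of i "{..<n}" "\<lambda>j. (x j + y j)\<^sup>2"]
    by (auto simp: E_def)
  have coord: "(x j)\<^sup>2 \<le> 2 * b + 2 * (x j + y j)\<^sup>2" if j: "j < n" for j
  proof (cases "i < n")
    case True
    have "0 \<le> x i" "0 \<le> y i" "x j \<le> x i" "y j \<le> y i"
      using x y j True by (auto simp: max_coord_cell_def)
    \<comment> \<open>If \<open>x j\<close> is nonnegative, it is at most \<open>x i\<close>, hence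
      at most \<open>x i + y i\<close>. Otherwise \<open>- x j = y j - (x j + y j)\<close>, where
      \<open>y j\<close> is at most \<open>y i\<close>, hence at most
      \<open>x i + y i\<close>.\<close>
    then have "\<bar>x j\<bar> \<le> \<bar>x i + y i\<bar> + \<bar>x j + y j\<bar>" by linarith
    then have "(x j)\<^sup>2 \<le> (\<bar>x i + y i\<bar> + \<bar>x j + y j\<bar>)\<^sup>2"
      by (metis abs_ge_zero power2_abs power_mono)
    also have "\<dots> \<le> 2 * \<bar>x i + y i\<bar>\<^sup>2 + 2 * \<bar>x j + y j\<bar>\<^sup>2"
      using sum_squares_bound[of "\<bar>x i + y i\<bar>" "\<bar>x j + y j\<bar>"] unfolding power2_sum by linarith
    finally show ?thesis using True by (simp add: b_def)
  next
    case False
    then have "x j \<le> 0" "y j \<le> 0" using x y j by (auto simp: max_coord_cell_def)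
    \<comment> \<open>Equal signs rule out cancellation.\<close>
    then have "\<bar>x j\<bar> \<le> \<bar>x j + y j\<bar>" by linarith
    then have "(x j)\<^sup>2 \<le> (x j + y j)\<^sup>2" by (simp add: abs_le_square_iff)
    moreover have "0 \<le> (x j + y j)\<^sup>2" by simp
    ultimately have "(x j)\<^sup>2 \<le> 2 * (x j + y j)\<^sup>2" by linarith
    then show ?thesis using False by (simp add: b_def)
  qed
  have "(\<Sum>j<n. (x j)\<^sup>2) \<le> (\<Sum>j<n. 2 * b + 2 * (x j + y j)\<^sup>2)"
    using coord by (intro sum_mono) auto
  also have "\<dots> = 2 * real n * b + 2 * E"
    by (simp add: E_def sum.distrib sum_distrib_left)
  also have "\<dots> \<le> 2 * real n * E + 2 * E"
    using b by (simp add: mult_left_mono)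
  finally show ?thesis by (simp add: E_def algebra_simps)
qed

lemma euclid_norm_power2: "(euclid_norm n x)\<^sup>2 = (\<Sum>j<n. (x j)\<^sup>2)"
  by (simp add: euclid_norm_def L2_set_def sum_nonneg)

lemma euclid_parallelogram:
  "(\<Sum>j<n. (x j + y j)\<^sup>2) = 2 * (euclid_norm n x)\<^sup>2 + 2 * (euclid_norm n y)\<^sup>2 - (euclid_dist n x y)\<^sup>2"
  unfolding euclid_dist_def euclid_norm_power2 sum_distrib_left
    sum.distrib[symmetric] sum_subtractf[symmetric]
  by (intro sum.cong) (auto simp: power2_eq_square algebra_simps)

lemma max_coord_cell_sphere_dist_neq_1:
  assumes n: "n \<ge> 1" and r: "0 < r" "r \<le> 1 / 2 + 1 / 100 / real n"
    and xS: "x \<in> euclid_sphere n r" and yS: "y \<in> euclid_sphere n r"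
    and cell: "max_coord_cell n x i" "max_coord_cell n y i"
  shows "euclid_dist n x y \<noteq> 1"
proof
  assume dist: "euclid_dist n x y = 1"
  have nx: "euclid_norm n x = r" and ny: "euclid_norm n y = r"
    using xS yS by (auto simp: euclid_sphere_def)
  have sum_eq: "(\<Sum>j<n. (x j + y j)\<^sup>2) = 4 * r\<^sup>2 - 1"
    by (simp add: euclid_parallelogram nx ny dist)
  have key: "r\<^sup>2 \<le> 2 * (real n + 1) * (4 * r\<^sup>2 - 1)"
    using max_coord_cell_sum_squares_le[OF cell] unfolding sum_eq
    by (simp add: euclid_norm_power2[symmetric] nx)
  have "0 \<le> (\<Sum>j<n. (x j + y j)\<^sup>2)" by (simp add: sum_nonneg)
  \<comment> \<open>Two points at distance 1 force the diameter \<open>2 * r\<close> to be at least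
    1.\<close>
  then have quarter: "1 / 4 \<le> r\<^sup>2" using sum_eq by linarith
  define t where "t = 1 / real n"
  have t: "0 < t" "t \<le> 1" "real n * t = 1" using n by (auto simp: t_def)
  have "r \<le> 1 / 2 + t / 100" using r(2) by (simp add: t_def)
  then have "r\<^sup>2 \<le> (1 / 2 + t / 100)\<^sup>2" using r(1) by (intro power_mono) auto
  also have "\<dots> = 1 / 4 + t / 100 + t * t / 10000" by (simp add: power2_eq_square field_simps)
  also have "\<dots> \<le> 1 / 4 + t / 100 + t / 10000"
    using mult_left_mono[of t 1 t] t by simp
  finally have le: "4 * r\<^sup>2 - 1 \<le> t / 20" using t(1) by linarith
  \<comment> \<open>The gap \<open>t / 20\<close> absorbs the factor \<open>n + 1\<close>: the
    right-hand side is at most 1/5, below the 1/4 required by \<open>quarter\<close>. The constant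
    1/100 leaves room for this.\<close>
  note key
  also have "2 * (real n + 1) * (4 * r\<^sup>2 - 1) \<le> 2 * (real n + 1) * (t / 20)"
    using le by (intro mult_left_mono) auto
  also have "\<dots> = (1 + t) / 10" using t(3) by (simp add: algebra_simps)
  also have "\<dots> < 1 / 4" using t(2) by simp
  finally show False using quarter by simp
qed

lemma unit_distance_chromatic_number_le:
  "unit_distance_colouring n S k col \<Longrightarrow> unit_distance_chromatic_number n S \<le> enat k"
  unfolding unit_distance_chromatic_number_def by (intro Inf_lower) blast

lemma chromatic_number_sphere_le:
  assumes "n \<ge> 1" "0 < r" "r \<le> 1 / 2 + 1 / 100 / real n"
  shows "unit_distance_chromatic_number n (euclid_sphere n r) \<le> enat (n + 1)"
proof -
  obtain col where col: "\<And>x. max_coord_cell n x (col x)"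
    using max_coord_cell_exists by metis
  have "unit_distance_colouring n (euclid_sphere n r) (n + 1) col"
    unfolding unit_distance_colouring_def
    using max_coord_cell_sphere_dist_neq_1[OF assms] col max_coord_cell_le by metis
  then show ?thesis by (rule unit_distance_chromatic_number_le)
qed

theorem theorem8:
  shows "\<exists>c2::real. c2 > 0 \<and>
    (\<forall>r::nat \<Rightarrow> real.
       (\<forall>n\<ge>1. 0 < r n \<and> r n \<le> 1 / 2 + c2 / real n) \<longrightarrow>
       (\<exists>n0::nat. \<forall>n\<ge>n0.
          unit_distance_chromatic_number n (euclid_sphere n (r n)) \<le> enat (n + 1)))"
  \<comment> \<open>The bound holds in every dimension from 1 on, so \<open>n0 = 1\<close>
    suffices.\<close>
  using chromatic_number_sphere_le by (intro exI[of _ "1 / 100"]) auto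

end
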